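(* Let $G:[0,1]\to(0,1)$ be continuous and nondecreasing. For each integer $N\ge1$ let $s(N;G)$ be the speed of the random walk excited by its recent history with history window $N$ and $N$ threshold levels $M_i=i$, $i=1,\dots,N$, with probabilities $p_i=G(\frac iN)$, $i=0,\dots,N$. Let $$ F(p):=\int_0^p\log\frac{G(x)}{1-G(x)}\,dx-p\log p-(1-p)\log(1-p),\qquad 0<p<1. $$ Then $F$ attains a maximum on $(0,1)$, and any point at which $F$ attains its maximum is a fixed point of $G$ (i.e. a point $p\in(0,1)$ with $G(p)=p$). In particular, a sufficient condition for $F$ to attain its maximum uniquely is that $G$ have a unique fixed point. If $F$ attains its maximum uniquely at $p^*$, then $$ \lim_{N\to\infty}s(N;G)=2p^*-1. $$
   Context: The process: $\{X_n\}_{n=0}^\infty$ takes values in $\mathbb{Z}$, starts from a fixed integer $X_0$, and at each step jumps by $+1$ (right) or $-1$ (left). Each of the first $N$ jumps is, independently, to the right with probability $p_0=G(0)$ and to the left with probability $1-p_0$. At every subsequent step, conditionally on the whole past: if exactly $j$ of the $N$ most recent jumps were to the right ($0\le j\le N$), the next jump is to the right with probability $G(\frac jN)$ and to the left with probability $1-G(\frac jN)$. The speed $s(N;G)$ is the deterministic constant $\lim_{n\to\infty}X_n/n$ (almost sure limit); it exists and is given by $$ s(N;G)=\frac{\sum_{i=0}^N\frac1{1-G(\frac iN)}\left(\prod_{k=1}^i\frac{G(\frac{k-1}N)}{1-G(\frac{k-1}N)}\right)\binom Ni\left(\frac{2i}N-1\right)}{\sum_{i=0}^N\frac1{1-G(\frac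 iN)}\left(\prod_{k=1}^i\frac{G(\frac{k-1}N)}{1-G(\frac{k-1}N)}\right)\binom Ni}, $$ where a void product $\prod_{k=1}^0$ equals $1$. *)

theory Defs
  imports "HOL-Probability.Probability"
begin

text \<open>Number of jumps to the right among the \<open>N\<close> most recent jumps of the path \<open>x\<close>
  at time \<open>n\<close>; only used for \<open>n \<ge> N\<close>.\<close>

definition recent_right_jumps :: "nat \<Rightarrow> (nat \<Rightarrow> int) \<Rightarrow> nat \<Rightarrow> nat" where
  "recent_right_jumps N x n = card {k \<in> {n - N..<n}. x (Suc k) = x k + 1}"

text \<open>A realization \<open>X\<close>, on an arbitrary probability space, of the walk excited by its recent
  history with window \<open>N\<close> and thresholds \<open>1, \<dots>, N\<close>: the jump probability to the right is \<open>p j\<close>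
  if exactly \<open>j\<close> of the last \<open>N\<close> jumps were to the right. Conditioning on the whole past is
  elementary conditioning on the path up to time \<open>n\<close>, since the walk is discrete. The
  probabilities of jumps to the left are determined by \<open>nearest_neighbour\<close>.\<close>

locale recent_history_walk = prob_space M
  for M :: "'a measure" +
  fixes N :: nat and p :: "nat \<Rightarrow> real" and x0 :: int and X :: "nat \<Rightarrow> 'a \<Rightarrow> int"
  assumes measurable_walk: "\<And>n. X n \<in> measurable M (count_space UNIV)"
    and start: "AE \<omega> in M. X 0 \<omega> = x0"
    and nearest_neighbour: "\<And>n. AE \<omega> in M. X (Suc n) \<omega> - X n \<omega> \<in> {1, - 1}"
    and initial_indep:
      "indep_vars (\<lambda>_. count_space UNIV) (\<lambda>k \<omega>. X (Suc k) \<omega> - X k \<omega>) {..<N}"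
    and initial_prob:
      "\<And>k. k < N \<Longrightarrow> \<P>(\<omega> in M. X (Suc k) \<omega> - X k \<omega> = 1) = p 0"
    and step_prob:
      "\<And>n x. n \<ge> N \<Longrightarrow> \<P>(\<omega> in M. \<forall>k\<le>n. X k \<omega> = x k) > 0 \<Longrightarrow>
        \<P>(\<omega> in M. X (Suc n) \<omega> - X n \<omega> = 1 \<bar> \<forall>k\<le>n. X k \<omega> = x k)
          = p (recent_right_jumps N x n)"

definition has_speed :: "'a measure \<Rightarrow> (nat \<Rightarrow> 'a \<Rightarrow> int) \<Rightarrow> real \<Rightarrow> bool" where
  "has_speed M X s \<longleftrightarrow> (AE \<omega> in M. (\<lambda>n. real_of_int (X n \<omega>) / real n) \<longlonglongrightarrow> s)"

definition potential :: "(real \<Rightarrow> real) \<Rightarrow> real \<Rightarrow> real" where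
  "potential G p =
     integral {0..p} (\<lambda>x. ln (G x / (1 - G x))) - p * ln p - (1 - p) * ln (1 - p)"

definition attains_max_at :: "(real \<Rightarrow> real) \<Rightarrow> real \<Rightarrow> bool" where
  "attains_max_at F p \<longleftrightarrow> is_arg_max F (\<lambda>q. q \<in> {0<..<1}) p"

end

theory Submission
  imports Defs
begin

text \<open>
  For the window chain on \<open>{0,1}\<^sup>N\<close>, the weight
  \<open>(\<Prod>k<i. p k / (1 - p k)) / (1 - p i)\<close> of a window with \<open>i\<close> jumps to the right is stationary.
  Since every initial window has positive probability, one can reweight the probability measure by a
  function of the initial window so that the chain becomes stationary. The almost sure speed \<open>s\<close>
  is unaffected by this absolutely continuous change of measure, so by dominated convergence it is
  the stationary mean of \<open>2 * p i - 1\<close>; no ergodic theorem is needed.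

  For \<open>p i = G (i / N)\<close> the stationary probability of \<open>i\<close> jumps to the right is proportional to
  \<open>exp (N * F (i / N))\<close> up to a polynomial factor, because the binomial coefficient contributes the
  entropy and the product is a Riemann sum of \<open>ln (G / (1 - G))\<close>. Hence it concentrates at the
  unique maximizer \<open>p*\<close> of \<open>F\<close>, and the speed converges to \<open>2 * G p* - 1 = 2 * p* - 1\<close>.
\<close>

subsection \<open>Stationary weights and the speed of the walk\<close>


text \<open>This is the weight of one single window with \<open>i\<close> right jumps. The number of
  such windows enters separately, as a binomial coefficient.\<close>

definition stationary_weight :: "(nat \<Rightarrow> real) \<Rightarrow> nat \<Rightarrow> real" where
  "stationary_weight p i = (\<Prod>k<i. p k / (1 - p k)) / (1 - p i)"

lemma stationary_weight_pos:
  assumes "\<And>k. k \<le> i \<Longrightarrow> 0 < p k \<and> p k < 1"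
  shows "0 < stationary_weight p i"
  unfolding stationary_weight_def using assms by (intro divide_pos_pos prod_pos) auto

text \<open>This is the balance relation behind stationarity. If \<open>i\<close> of the
  \<open>N - 1\<close> jumps that stay in the window are to the right, the window before the step
  had \<open>i\<close> or \<open>Suc i\<close> right jumps, according to the jump that is dropped.
  The inflow into either new window then reduces to this identity.\<close>

lemma stationary_weight_Suc:
  assumes "p i < 1" "p (Suc i) < 1"
  shows "stationary_weight p (Suc i) * (1 - p (Suc i)) = stationary_weight p i * p i"
  using assms by (simp add: stationary_weight_def)

lemma sum_card_Pow:
  fixes f :: "nat \<Rightarrow> real"
  assumes "finite A"
  shows "(\<Sum>C\<in>Pow A. f (card C)) = (\<Sum>i\<le>card A. real (card A choose i) * f i)"
proof -
  have "(\<Sum>C\<in>Pow A. f (card C)) = (\<Sum>i\<le>card A. \<Sum>C\<in>{C\<in>Pow A. card C = i}. f (card C))"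
    using assms by (intro sum.group[symmetric]) (auto intro: card_mono)
  also have "\<dots> = (\<Sum>i\<le>card A. real (card A choose i) * f i)"
    using n_subsets[OF assms] by (intro sum.cong) (auto simp: Pow_def)
  finally show ?thesis .
qed

section \<open>The law of the set of right jumps\<close>

context recent_history_walk
begin

text \<open>The history is encoded as a finite set of times, so that laws become finite sums over
  \<open>Pow {..<n}\<close>. Together with the starting point this set determines the path almost
  surely.\<close>

definition right_jumps :: "nat \<Rightarrow> 'a \<Rightarrow> nat set" where
  "right_jumps n \<omega> = {k. k < n \<and> X (Suc k) \<omega> = X k \<omega> + 1}"

lemma right_jumps_subset: "right_jumps n \<omega> \<subseteq> {..<n}"
  by (auto simp: right_jumps_def)

lemma right_jumps_restrict: "m \<le> n \<Longrightarrow> right_jumps n \<omega> \<inter> {..<m} = right_jumps m \<omega>"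
  by (auto simp: right_jumps_def)

lemma right_jumps_Suc:
  "right_jumps (Suc n) \<omega> =
    (if X (Suc n) \<omega> = X n \<omega> + 1 then insert n (right_jumps n \<omega>) else right_jumps n \<omega>)"
  by (auto simp: right_jumps_def less_Suc_eq)

lemma measurable_walk' [measurable]: "X n \<in> measurable M (count_space UNIV)"
  by (rule measurable_walk)

lemma right_jumps_sets [measurable]: "{\<omega>\<in>space M. right_jumps n \<omega> = B} \<in> sets M"
proof -
  have "{\<omega>\<in>space M. right_jumps n \<omega> = B} =
    (if B \<subseteq> {..<n} then {\<omega>\<in>space M. \<forall>k\<in>{..<n}. (X (Suc k) \<omega> = X k \<omega> + 1) = (k \<in> B)} else {})"
    by (auto simp: right_jumps_def)
  also have "\<dots> \<in> sets M"
    by auto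
  finally show ?thesis .
qed

text \<open>Independence factorizes the event into single jumps, each of probability
  \<open>p 0\<close> or \<open>1 - p 0\<close>. Positivity is what allows division by this
  probability in \<open>density\<close>.\<close>

lemma prob_right_jumps_initial:
  assumes "1 \<le> N" "B \<subseteq> {..<N}" "0 < p 0" "p 0 < 1"
  shows "0 < \<P>(\<omega> in M. right_jumps N \<omega> = B)"
proof -
  define Y where "Y = (\<lambda>k \<omega>. X (Suc k) \<omega> - X k \<omega>)"
  \<comment> \<open>The complement of \<open>{1}\<close> is taken instead of \<open>{-1}\<close>:
    the event then equals the product event everywhere, and not only almost surely.\<close>
  define A :: "nat \<Rightarrow> int set" where "A = (\<lambda>k. if k \<in> B then {1} else - {1})"
  have "{\<omega>\<in>space M. right_jumps N \<omega> = B} = (\<Inter>k\<in>{..<N}. Y k -` A k \<inter> space M)"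
  proof -
    have "0 < N" using assms by simp
    have "right_jumps N \<omega> = B \<longleftrightarrow> (\<forall>k<N. Y k \<omega> \<in> A k)" for \<omega>
      using assms(2) by (auto simp: right_jumps_def Y_def A_def algebra_simps split: if_splits)
    with \<open>0 < N\<close> show ?thesis by auto
  qed
  then have "\<P>(\<omega> in M. right_jumps N \<omega> = B) = (\<Prod>k\<in>{..<N}. prob (Y k -` A k \<inter> space M))"
    using indep_varsD[OF initial_indep, of "{..<N}" A] assms(1)
    by (simp add: Y_def lessThan_empty_iff)
  moreover have "0 < prob (Y k -` A k \<inter> space M)" if "k < N" for k
  proof -
    have 1: "\<P>(\<omega> in M. Y k \<omega> = 1) = p 0"
      using initial_prob[OF that] by (simp add: Y_def)
    have "\<P>(\<omega> in M. Y k \<omega> \<noteq> 1) = 1 - \<P>(\<omega> in M. Y k \<omega> = 1)"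
      unfolding Y_def by (rule prob_neg) measurable
    with 1 assms(3,4) have "0 < \<P>(\<omega> in M. Y k \<omega> = 1)" "0 < \<P>(\<omega> in M. Y k \<omega> \<noteq> 1)"
      by auto
    moreover have "Y k -` A k \<inter> space M =
        (if k \<in> B then {\<omega>\<in>space M. Y k \<omega> = 1} else {\<omega>\<in>space M. Y k \<omega> \<noteq> 1})"
      by (auto simp: A_def)
    ultimately show ?thesis by auto
  qed
  ultimately show ?thesis by (auto intro: prod_pos)
qed

lemma AE_walk_steps:
  "AE \<omega> in M. X 0 \<omega> = x0 \<and> (\<forall>n. X (Suc n) \<omega> - X n \<omega> = 1 \<or> X (Suc n) \<omega> - X n \<omega> = -1)"
  using start nearest_neighbour by (auto simp: AE_all_countable)

text \<open>This turns the conditional law given the path into a multiplicative recursion for the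
  probabilities of histories, valid also for histories of probability zero.\<close>

lemma prob_right_jumps_step:
  assumes "N \<le> n" "B \<subseteq> {..<n}"
  shows "\<P>(\<omega> in M. right_jumps (Suc n) \<omega> = insert n B) =
      p (card (B \<inter> {n - N..<n})) * \<P>(\<omega> in M. right_jumps n \<omega> = B)" (is ?right)
    and "\<P>(\<omega> in M. right_jumps (Suc n) \<omega> = B) =
      (1 - p (card (B \<inter> {n - N..<n}))) * \<P>(\<omega> in M. right_jumps n \<omega> = B)" (is ?left)
proof -
  \<comment> \<open>The nearest-neighbour path from \<open>x0\<close> whose right jumps are exactly
    those in \<open>B\<close>.\<close>
  define x where "x = (\<lambda>k. x0 + (\<Sum>j<k. if j \<in> B then 1 else - 1))"
  have x_Suc: "x (Suc k) = x k + (if k \<in> B then 1 else - 1)" for k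
    by (simp add: x_def)
  have path: "AE \<omega> in M. (\<forall>k\<le>n. X k \<omega> = x k) \<longleftrightarrow> right_jumps n \<omega> = B"
    using AE_walk_steps
  proof eventually_elim
    case (elim \<omega>)
    show ?case
    proof
      assume "\<forall>k\<le>n. X k \<omega> = x k"
      then have "X (Suc k) \<omega> = X k \<omega> + 1 \<longleftrightarrow> k \<in> B" if "k < n" for k
        using that by (simp add: x_Suc)
      then show "right_jumps n \<omega> = B"
        using assms(2) by (auto simp: right_jumps_def)
    next
      assume B: "right_jumps n \<omega> = B"
      have "k \<le> n \<Longrightarrow> X k \<omega> = x k" for k
      proof (induction k)
        case 0
        then show ?case using elim by (simp add: x_def)
      next
        case (Suc k)
        from Suc.prems B have "X (Suc k) \<omega> = X k \<omega> + 1 \<longleftrightarrow> k \<in> B"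
          by (auto simp: right_jumps_def)
        with elim have "X (Suc k) \<omega> = X k \<omega> + (if k \<in> B then 1 else - 1)"
          by (smt (verit))
        with Suc show ?case by (simp add: x_Suc)
      qed
      then show "\<forall>k\<le>n. X k \<omega> = x k" by blast
    qed
  qed
  have recent: "recent_right_jumps N x n = card (B \<inter> {n - N..<n})"
    unfolding recent_right_jumps_def by (rule arg_cong[where f = card]) (auto simp: x_Suc)
  have nB: "n \<notin> B" using assms(2) by auto
  have prob_path: "\<P>(\<omega> in M. \<forall>k\<le>n. X k \<omega> = x k) = \<P>(\<omega> in M. right_jumps n \<omega> = B)"
    by (rule prob_eq_AE) (use path in auto)
  have "\<P>(\<omega> in M. right_jumps (Suc n) \<omega> = insert n B) =
      \<P>(\<omega> in M. X (Suc n) \<omega> - X n \<omega> = 1 \<and> (\<forall>k\<le>n. X k \<omega> = x k))"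
  proof (rule prob_eq_AE)
    show "AE \<omega> in M. right_jumps (Suc n) \<omega> = insert n B \<longleftrightarrow>
        X (Suc n) \<omega> - X n \<omega> = 1 \<and> (\<forall>k\<le>n. X k \<omega> = x k)"
      using path
    proof eventually_elim
      case (elim \<omega>)
      have "n \<notin> right_jumps n \<omega>" by (auto simp: right_jumps_def)
      with elim nB show ?case
        by (auto simp: right_jumps_Suc insert_ident split: if_splits)
    qed
  qed auto
  also have "\<dots> = p (card (B \<inter> {n - N..<n})) * \<P>(\<omega> in M. right_jumps n \<omega> = B)"
  \<comment> \<open>\<open>step_prob\<close> speaks only of paths of positive probability; for a
    null path both sides vanish.\<close>
  proof (cases "0 < \<P>(\<omega> in M. \<forall>k\<le>n. X k \<omega> = x k)")
    case True
    from step_prob[OF assms(1) True] True show ?thesis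
      by (simp add: cond_prob_def recent prob_path field_simps)
  next
    case False
    then have 0: "\<P>(\<omega> in M. \<forall>k\<le>n. X k \<omega> = x k) = 0"
      by (simp add: not_less measure_le_0_iff)
    have "\<P>(\<omega> in M. X (Suc n) \<omega> - X n \<omega> = 1 \<and> (\<forall>k\<le>n. X k \<omega> = x k))
        \<le> \<P>(\<omega> in M. \<forall>k\<le>n. X k \<omega> = x k)"
      by (rule finite_measure_mono) auto
    then show ?thesis
      using 0 prob_path by (simp add: measure_le_0_iff)
  qed
  finally show right: ?right .
  \<comment> \<open>A history \<open>B\<close> has exactly two disjoint continuations, so the case
    of a left jump follows by subtraction.\<close>
  have "{\<omega>\<in>space M. right_jumps n \<omega> = B} =
      {\<omega>\<in>space M. right_jumps (Suc n) \<omega> = B} \<union> {\<omega>\<in>space M. right_jumps (Suc n) \<omega> = insert n B}"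
  proof -
    have "right_jumps n \<omega> = B \<longleftrightarrow>
        right_jumps (Suc n) \<omega> = B \<or> right_jumps (Suc n) \<omega> = insert n B" for \<omega>
    proof -
      have "n \<notin> right_jumps n \<omega>" by (auto simp: right_jumps_def)
      with nB show ?thesis by (auto simp: right_jumps_Suc insert_ident)
    qed
    then show ?thesis by auto
  qed
  moreover have "prob ({\<omega>\<in>space M. right_jumps (Suc n) \<omega> = B} \<union>
      {\<omega>\<in>space M. right_jumps (Suc n) \<omega> = insert n B}) =
      \<P>(\<omega> in M. right_jumps (Suc n) \<omega> = B) + \<P>(\<omega> in M. right_jumps (Suc n) \<omega> = insert n B)"
    using nB by (intro finite_measure_Union) auto
  ultimately show ?left
    using right by (simp add: algebra_simps)
qed

text \<open>The history up to time \<open>n\<close> takes finitely many values, so \<open>g\<close>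
  of it is a finite combination of indicators.\<close>

lemma expectation_right_jumps:
  fixes g :: "nat set \<Rightarrow> real"
  shows "integrable M (\<lambda>\<omega>. g (right_jumps n \<omega>))"
    and "expectation (\<lambda>\<omega>. g (right_jumps n \<omega>)) =
      (\<Sum>B\<in>Pow {..<n}. g B * \<P>(\<omega> in M. right_jumps n \<omega> = B))"
proof -
  have eq: "g (right_jumps n \<omega>) =
      (\<Sum>B\<in>Pow {..<n}. g B * indicator {\<omega>\<in>space M. right_jumps n \<omega> = B} \<omega>)"
    if "\<omega> \<in> space M" for \<omega>
  proof -
    have "(\<Sum>B\<in>Pow {..<n}. g B * indicator {\<omega>\<in>space M. right_jumps n \<omega> = B} \<omega>) =
        (\<Sum>B\<in>{right_jumps n \<omega>}. g B * indicator {\<omega>\<in>space M. right_jumps n \<omega> = B} \<omega>)"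
      using right_jumps_subset that by (intro sum.mono_neutral_right) (auto simp: indicator_def)
    then show ?thesis using that by (simp add: indicator_def)
  qed
  have int: "integrable M (\<lambda>\<omega>. g B * indicator {\<omega>\<in>space M. right_jumps n \<omega> = B} \<omega>)" for B
    by (intro integrable_mult_right integrable_real_indicator) (auto simp: emeasure_eq_measure)
  show "integrable M (\<lambda>\<omega>. g (right_jumps n \<omega>))"
    by (subst Bochner_Integration.integrable_cong[OF refl eq])
      (use int in \<open>auto intro!: Bochner_Integration.integrable_sum simp del: sum_mult_indicator\<close>)
  have "expectation (\<lambda>\<omega>. g (right_jumps n \<omega>)) =
      expectation (\<lambda>\<omega>. \<Sum>B\<in>Pow {..<n}. g B * indicator {\<omega>\<in>space M. right_jumps n \<omega> = B} \<omega>)"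
    by (rule Bochner_Integration.integral_cong[OF refl eq])
  also have "\<dots> = (\<Sum>B\<in>Pow {..<n}.
      expectation (\<lambda>\<omega>. g B * indicator {\<omega>\<in>space M. right_jumps n \<omega> = B} \<omega>))"
    by (rule Bochner_Integration.integral_sum) (rule int)
  also have "\<dots> = (\<Sum>B\<in>Pow {..<n}. g B * \<P>(\<omega> in M. right_jumps n \<omega> = B))"
    by (intro sum.cong refl) (simp add: Int_absorb1 Collect_restrict)
  finally show "expectation (\<lambda>\<omega>. g (right_jumps n \<omega>)) =
      (\<Sum>B\<in>Pow {..<n}. g B * \<P>(\<omega> in M. right_jumps n \<omega> = B))" .
qed

end

section \<open>Reweighting the initial window to reach stationarity\<close>

locale elliptic_recent_history_walk = recent_history_walk +
  assumes window_pos: "1 \<le> N"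
    and prob_bounds: "\<And>i. i \<le> N \<Longrightarrow> 0 < p i \<and> p i < 1"
begin

text \<open>Under the measure with this (unnormalized) density in the initial window, the window chain
  starts from its stationary law.\<close>

definition density :: "nat set \<Rightarrow> real" where
  "density C = stationary_weight p (card C) / \<P>(\<omega> in M. right_jumps N \<omega> = C)"

text \<open>For \<open>N \<le> n\<close>, this is the mass of the history \<open>B\<close> under the
  reweighted measure. The density looks only at the first \<open>N\<close> jumps, so all later
  transition probabilities stay the same.\<close>

definition reweighted :: "nat \<Rightarrow> nat set \<Rightarrow> real" where
  "reweighted n B = density (B \<inter> {..<N}) * \<P>(\<omega> in M. right_jumps n \<omega> = B)"

lemma reweighted_step:
  assumes "N \<le> n" "B \<subseteq> {..<n}"
  shows "reweighted (Suc n) (insert n B) = p (card (B \<inter> {n - N..<n})) * reweighted n B"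
    and "reweighted (Suc n) B = (1 - p (card (B \<inter> {n - N..<n}))) * reweighted n B"
proof -
  have "insert n B \<inter> {..<N} = B \<inter> {..<N}" using assms by auto
  then show "reweighted (Suc n) (insert n B) = p (card (B \<inter> {n - N..<n})) * reweighted n B"
    by (simp add: reweighted_def prob_right_jumps_step(1)[OF assms])
  show "reweighted (Suc n) B = (1 - p (card (B \<inter> {n - N..<n}))) * reweighted n B"
    by (simp add: reweighted_def prob_right_jumps_step(2)[OF assms])
qed

text \<open>Stationarity, by induction on time: the base case holds by the choice of
  \<open>density\<close>, and the step is the balance relation
  \<open>stationary_weight_Suc\<close>.\<close>

lemma reweighted_window:
  assumes "N \<le> n" "C \<subseteq> {n - N..<n}"
  shows "(\<Sum>B | B \<subseteq> {..<n} \<and> B \<inter> {n - N..<n} = C. reweighted n B) = stationary_weight p (card C)"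
  using assms
proof (induction n arbitrary: C rule: dec_induct)
  case base
  then have C: "C \<subseteq> {..<N}" by auto
  then have "{B. B \<subseteq> {..<N} \<and> B \<inter> {N - N..<N} = C} = {C}" by auto
  moreover have "0 < \<P>(\<omega> in M. right_jumps N \<omega> = C)"
    using prob_right_jumps_initial[OF window_pos C] prob_bounds[of 0] by simp
  moreover have "C \<inter> {..<N} = C" using C by auto
  ultimately show ?case by (simp add: reweighted_def density_def)
next
  case (step n)
  \<comment> \<open>\<open>m\<close> is the oldest jump of the window at time \<open>n\<close>, the
    one dropped at time \<open>Suc n\<close>; \<open>C'\<close> collects the right jumps among the
    \<open>N - 1\<close> jumps common to both windows.\<close>
  define m where "m = n - N"
  have m: "m < n" "Suc n - N = Suc m" "n = m + N"
    using step.hyps window_pos by (auto simp: m_def)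
  define C' where "C' = C - {n}"
  have C': "C' \<subseteq> {Suc m..<n}" using step.prems m by (auto simp: C'_def)
  have fin: "finite C'" using C' finite_subset by blast
  define q where "q = (\<lambda>i. if n \<in> C then p i else 1 - p i)"
  \<comment> \<open>\<open>f\<close> appends to a history the new jump prescribed by
    \<open>C\<close>, and \<open>q\<close> is the probability of that jump.\<close>
  define f where "f = (\<lambda>B. if n \<in> C then insert n B else B)"
  have cC': "card C' < N" using card_mono[OF _ C'] m by auto
  have cins: "card (insert m C') = Suc (card C')" using C' fin by (subst card_insert_disjoint) auto
  have IH: "(\<Sum>B | B \<subseteq> {..<n} \<and> B \<inter> {m..<n} = D. reweighted (Suc n) (f B)) =
      q (card D) * stationary_weight p (card D)" if "D \<subseteq> {m..<n}" for D
  proof -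
    have "(\<Sum>B | B \<subseteq> {..<n} \<and> B \<inter> {m..<n} = D. reweighted (Suc n) (f B)) =
        (\<Sum>B | B \<subseteq> {..<n} \<and> B \<inter> {m..<n} = D. q (card D) * reweighted n B)"
      using reweighted_step[OF step.hyps(1)] by (intro sum.cong) (auto simp: f_def q_def m_def)
    also have "\<dots> = q (card D) * stationary_weight p (card D)"
      using step.IH[of D] that by (simp add: m_def flip: sum_distrib_left)
    finally show ?thesis .
  qed
  let ?A = "\<lambda>D. {B. B \<subseteq> {..<n} \<and> B \<inter> {m..<n} = D}"
  have finA: "finite (?A D)" for D by (rule finite_subset[of _ "Pow {..<n}"]) auto
  \<comment> \<open>The histories ending in \<open>C\<close> are the extensions of those whose
    previous window was \<open>C'\<close> or \<open>insert m C'\<close>: the dropped jump was to the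
    left or to the right.\<close>
  have img: "{B. B \<subseteq> {..<Suc n} \<and> B \<inter> {Suc n - N..<Suc n} = C} = f ` (?A C' \<union> ?A (insert m C'))"
  proof (intro equalityI subsetI)
    fix B assume "B \<in> {B. B \<subseteq> {..<Suc n} \<and> B \<inter> {Suc n - N..<Suc n} = C}"
    then have B: "B \<subseteq> {..<Suc n}" "B \<inter> {Suc m..<Suc n} = C" by (auto simp: m)
    have "n \<in> B \<longleftrightarrow> n \<in> C" using B m by auto
    then have "B = f (B - {n})" by (auto simp: f_def)
    moreover have "B - {n} \<subseteq> {..<n}" using B by auto
    moreover have "(B - {n}) \<inter> {m..<n} = (if m \<in> B then insert m C' else C')"
    proof -
      have "{m..<n} = insert m {Suc m..<n}" using m by auto
      moreover have "(B - {n}) \<inter> {Suc m..<n} = C'" using B by (auto simp: C'_def)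
      ultimately show ?thesis using m by auto
    qed
    ultimately show "B \<in> f ` (?A C' \<union> ?A (insert m C'))"
      by (metis (mono_tags, lifting) UnCI image_eqI mem_Collect_eq)
  next
    fix B assume "B \<in> f ` (?A C' \<union> ?A (insert m C'))"
    then obtain B' where B': "B = f B'" "B' \<subseteq> {..<n}" "B' \<inter> {m..<n} = C' \<or> B' \<inter> {m..<n} = insert m C'"
      by auto
    have "B' \<inter> {Suc m..<n} = C'"
    proof -
      have "B' \<inter> {Suc m..<n} = (B' \<inter> {m..<n}) \<inter> {Suc m..<n}" by auto
      moreover have "insert m C' \<inter> {Suc m..<n} = C'" "C' \<inter> {Suc m..<n} = C'"
        using C' by auto
      ultimately show ?thesis using B'(3) by metis
    qed
    moreover have "{Suc m..<Suc n} = insert n {Suc m..<n}" using m by auto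
    ultimately have "B \<inter> {Suc m..<Suc n} = C"
      using B' m step.prems by (auto simp: f_def C'_def)
    with B' show "B \<in> {B. B \<subseteq> {..<Suc n} \<and> B \<inter> {Suc n - N..<Suc n} = C}"
      by (auto simp: f_def m)
  qed
  have inj: "inj_on f (?A C' \<union> ?A (insert m C'))"
    unfolding f_def by (rule inj_onI) (auto split: if_splits)
  have "(\<Sum>B | B \<subseteq> {..<Suc n} \<and> B \<inter> {Suc n - N..<Suc n} = C. reweighted (Suc n) B) =
      (\<Sum>B\<in>?A C' \<union> ?A (insert m C'). reweighted (Suc n) (f B))"
    unfolding img by (simp add: sum.reindex[OF inj])
  also have "\<dots> = (\<Sum>B\<in>?A C'. reweighted (Suc n) (f B)) + (\<Sum>B\<in>?A (insert m C'). reweighted (Suc n) (f B))"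
    using C' by (intro sum.union_disjoint finA) auto
  also have "\<dots> = q (card C') * stationary_weight p (card C') +
      q (Suc (card C')) * stationary_weight p (Suc (card C'))"
    using C' m by (subst (1 2) IH) (auto simp: cins)
  also have "\<dots> = stationary_weight p (card C)"
  proof -
    \<comment> \<open>Since \<open>card C' < N\<close>, the index \<open>Suc (card C')\<close> is
      still in the range where \<open>prob_bounds\<close> applies.\<close>
    have S: "stationary_weight p (Suc (card C')) * (1 - p (Suc (card C'))) =
        stationary_weight p (card C') * p (card C')"
      using cC' by (intro stationary_weight_Suc) (auto intro!: prob_bounds[THEN conjunct2])
    show ?thesis
    proof (cases "n \<in> C")
      case True
      then have "card C = Suc (card C')"
        using fin card_insert_disjoint[of C' n] by (simp add: C'_def insert_absorb)
      with True S show ?thesis by (simp add: q_def algebra_simps)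
    next
      case False
      then have "card C = card C'" by (simp add: C'_def)
      with False S show ?thesis by (simp add: q_def algebra_simps)
    qed
  qed
  finally show ?case .
qed

definition total_weight :: real where
  "total_weight = (\<Sum>i\<le>N. real (N choose i) * stationary_weight p i)"

text \<open>The drift \<open>2 * p i - 1\<close> of the next jump is averaged here, not the mean
  jump \<open>2 * i / N - 1\<close> within the window. Both have the same mean under the stationary
  law.\<close>

definition total_drift :: real where
  "total_drift = (\<Sum>i\<le>N. real (N choose i) * (stationary_weight p i * (2 * p i - 1)))"

text \<open>Histories are grouped by their last window, to which stationarity applies. The
  right-hand side is free of \<open>n\<close>.\<close>

lemma sum_reweighted:
  fixes f :: "nat \<Rightarrow> real"
  assumes "N \<le> n"
  shows "(\<Sum>B\<in>Pow {..<n}. reweighted n B * f (card (B \<inter> {n - N..<n}))) =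
    (\<Sum>i\<le>N. real (N choose i) * (stationary_weight p i * f i))"
proof -
  have "(\<Sum>B\<in>Pow {..<n}. reweighted n B * f (card (B \<inter> {n - N..<n}))) =
      (\<Sum>C\<in>Pow {n - N..<n}. \<Sum>B\<in>{B \<in> Pow {..<n}. B \<inter> {n - N..<n} = C}.
        reweighted n B * f (card (B \<inter> {n - N..<n})))"
    by (intro sum.group[symmetric]) auto
  also have "\<dots> = (\<Sum>C\<in>Pow {n - N..<n}.
      (\<Sum>B | B \<subseteq> {..<n} \<and> B \<inter> {n - N..<n} = C. reweighted n B) * f (card C))"
    unfolding sum_distrib_right by (intro sum.cong) auto
  also have "\<dots> = (\<Sum>C\<in>Pow {n - N..<n}. stationary_weight p (card C) * f (card C))"
    using reweighted_window[OF assms] by (intro sum.cong) auto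
  also have "\<dots> = (\<Sum>i\<le>N. real (N choose i) * (stationary_weight p i * f i))"
    using sum_card_Pow[of "{n - N..<n}" "\<lambda>i. stationary_weight p i * f i"] assms by simp
  finally show ?thesis .
qed

lemma expectation_density: "expectation (\<lambda>\<omega>. density (right_jumps N \<omega>)) = total_weight"
proof -
  have "expectation (\<lambda>\<omega>. density (right_jumps N \<omega>)) = (\<Sum>B\<in>Pow {..<N}. reweighted N B)"
    unfolding expectation_right_jumps(2) reweighted_def
    by (intro sum.cong) (auto simp: Int_absorb2)
  also have "\<dots> = total_weight"
    using sum_reweighted[of N "\<lambda>_. 1"] by (simp add: total_weight_def)
  finally show ?thesis .
qed

text \<open>Under the reweighted measure the mean jump is the same at every time from
  \<open>N\<close> on.\<close>

lemma drift_expectation: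
  assumes "N \<le> n"
  shows "integrable M (\<lambda>\<omega>. density (right_jumps N \<omega>) * real_of_int (X (Suc n) \<omega> - X n \<omega>))"
    and "expectation (\<lambda>\<omega>. density (right_jumps N \<omega>) * real_of_int (X (Suc n) \<omega> - X n \<omega>)) =
      total_drift"
proof -
  \<comment> \<open>Almost surely the integrand is this function of the history, so its expectation
    is a finite sum.\<close>
  define g :: "nat set \<Rightarrow> real" where
    "g = (\<lambda>B. density (B \<inter> {..<N}) * (if n \<in> B then 1 else - 1))"
  have ae: "AE \<omega> in M. density (right_jumps N \<omega>) * real_of_int (X (Suc n) \<omega> - X n \<omega>) =
      g (right_jumps (Suc n) \<omega>)"
    using AE_walk_steps
  proof eventually_elim
    case (elim \<omega>)
    have "n \<in> right_jumps (Suc n) \<omega> \<longleftrightarrow> X (Suc n) \<omega> - X n \<omega> = 1"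
      by (auto simp: right_jumps_def)
    with elim have "real_of_int (X (Suc n) \<omega> - X n \<omega>) = (if n \<in> right_jumps (Suc n) \<omega> then 1 else - 1)"
      by (smt (verit) of_int_1 of_int_minus)
    then show ?case
      using assms by (simp add: g_def right_jumps_restrict)
  qed
  have meas: "(\<lambda>\<omega>. density (right_jumps N \<omega>)) \<in> borel_measurable M"
    by (rule borel_measurable_integrable[OF expectation_right_jumps(1)])
  have meas': "(\<lambda>\<omega>. real_of_int (X (Suc n) \<omega> - X n \<omega>)) \<in> borel_measurable M"
    by measurable
  show "integrable M (\<lambda>\<omega>. density (right_jumps N \<omega>) * real_of_int (X (Suc n) \<omega> - X n \<omega>))"
    by (rule integrable_cong_AE_imp[OF expectation_right_jumps(1)[of g "Suc n"]])
      (use meas meas' ae in auto)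
  have "expectation (\<lambda>\<omega>. density (right_jumps N \<omega>) * real_of_int (X (Suc n) \<omega> - X n \<omega>)) =
      expectation (\<lambda>\<omega>. g (right_jumps (Suc n) \<omega>))"
    by (rule integral_cong_AE)
      (use meas meas' ae borel_measurable_integrable[OF expectation_right_jumps(1)] in auto)
  also have "\<dots> = (\<Sum>B\<in>Pow {..<Suc n}. (if n \<in> B then 1 else - 1) * reweighted (Suc n) B)"
    by (subst expectation_right_jumps(2)) (auto simp: g_def reweighted_def intro!: sum.cong)
  \<comment> \<open>Each history up to time \<open>n\<close> is paired with its two continuations,
    which count with opposite signs.\<close>
  also have "\<dots> = (\<Sum>B\<in>Pow {..<n}. reweighted (Suc n) (insert n B) - reweighted (Suc n) B)"
  proof -
    have inj: "inj_on (insert n) (Pow {..<n})" by (rule inj_onI) auto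
    have "(\<Sum>B\<in>Pow {..<Suc n}. (if n \<in> B then 1 else - 1) * reweighted (Suc n) B) =
        (\<Sum>B\<in>Pow {..<n} \<union> insert n ` Pow {..<n}. (if n \<in> B then 1 else - 1) * reweighted (Suc n) B)"
      by (simp add: lessThan_Suc Pow_insert)
    also have "\<dots> = (\<Sum>B\<in>Pow {..<n}. (if n \<in> B then 1 else - 1) * reweighted (Suc n) B) +
        (\<Sum>B\<in>insert n ` Pow {..<n}. (if n \<in> B then 1 else - 1) * reweighted (Suc n) B)"
      by (intro sum.union_disjoint) auto
    also have "(\<Sum>B\<in>Pow {..<n}. (if n \<in> B then 1 else - 1) * reweighted (Suc n) B) =
        (\<Sum>B\<in>Pow {..<n}. - reweighted (Suc n) B)"
      by (intro sum.cong) auto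
    also have "(\<Sum>B\<in>insert n ` Pow {..<n}. (if n \<in> B then 1 else - 1) * reweighted (Suc n) B) =
        (\<Sum>B\<in>Pow {..<n}. reweighted (Suc n) (insert n B))"
      by (simp add: sum.reindex[OF inj])
    finally show ?thesis by (simp add: sum_subtractf sum_negf)
  qed
  also have "\<dots> = (\<Sum>B\<in>Pow {..<n}. reweighted n B * (2 * p (card (B \<inter> {n - N..<n})) - 1))"
    using reweighted_step[OF assms] by (intro sum.cong) (auto simp: algebra_simps)
  also have "\<dots> = total_drift"
    unfolding total_drift_def by (rule sum_reweighted[OF assms])
  finally show "expectation (\<lambda>\<omega>. density (right_jumps N \<omega>) * real_of_int (X (Suc n) \<omega> - X n \<omega>)) =
      total_drift" .
qed

lemma total_weight_pos: "0 < total_weight"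
  unfolding total_weight_def
  by (intro sum_pos mult_pos_pos stationary_weight_pos) (auto intro: prob_bounds[THEN conjunct1] prob_bounds[THEN conjunct2])

text \<open>The limit of the weighted mean of \<open>X n / n\<close> is computed twice: dominated
  convergence gives \<open>total_weight * s\<close>, and summing the constant mean jumps gives
  \<open>total_drift\<close>.\<close>

theorem speed_formula:
  assumes "has_speed M X s"
  shows "s = total_drift / total_weight"
proof -
  let ?D = "\<lambda>\<omega>. density (right_jumps N \<omega>)"
  let ?e = "\<lambda>n. expectation (\<lambda>\<omega>. ?D \<omega> * (real_of_int (X n \<omega>) / real n))"
  have meas [measurable]: "?D \<in> borel_measurable M"
    by (rule borel_measurable_integrable[OF expectation_right_jumps(1)])
  have bound: "AE \<omega> in M. norm (?D \<omega> * (real_of_int (X n \<omega>) / real n)) \<le>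
      \<bar>?D \<omega>\<bar> * (\<bar>real_of_int x0\<bar> + 1)" for n
    using AE_walk_steps
  proof eventually_elim
    case (elim \<omega>)
    have "\<bar>X n \<omega>\<bar> \<le> \<bar>x0\<bar> + int n"
    proof (induction n)
      case (Suc n)
      then show ?case using elim by (smt (verit) of_nat_Suc)
    qed (use elim in auto)
    then have "\<bar>real_of_int (X n \<omega>)\<bar> \<le> \<bar>real_of_int x0\<bar> + real n"
      by linarith
    moreover have "\<bar>real_of_int x0\<bar> \<le> \<bar>real_of_int x0\<bar> * real n" if "n > 0"
      using that by (simp add: mult_le_cancel_left1)
    \<comment> \<open>At \<open>n = 0\<close> the quotient is 0 by the convention for division by
      zero, so the bound holds for all \<open>n\<close>.\<close>
    ultimately have "\<bar>real_of_int (X n \<omega>)\<bar> / real n \<le> \<bar>real_of_int x0\<bar> + 1"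
      by (cases "n = 0") (auto simp: field_simps)
    then have "\<bar>?D \<omega>\<bar> * (\<bar>real_of_int (X n \<omega>)\<bar> / real n) \<le> \<bar>?D \<omega>\<bar> * (\<bar>real_of_int x0\<bar> + 1)"
      by (intro mult_left_mono) auto
    then show ?case by (simp add: abs_mult)
  qed
  have int_abs: "integrable M (\<lambda>\<omega>. \<bar>?D \<omega>\<bar> * (\<bar>real_of_int x0\<bar> + 1))"
    using expectation_right_jumps(1)[of "\<lambda>B. \<bar>density B\<bar>" N] by simp
  have lim: "?e \<longlonglongrightarrow> expectation (\<lambda>\<omega>. ?D \<omega> * s)"
  proof (rule integral_dominated_convergence[where w = "\<lambda>\<omega>. \<bar>?D \<omega>\<bar> * (\<bar>real_of_int x0\<bar> + 1)"])
    show "AE \<omega> in M. (\<lambda>n. ?D \<omega> * (real_of_int (X n \<omega>) / real n)) \<longlonglongrightarrow> ?D \<omega> * s"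
      using assms unfolding has_speed_def by eventually_elim (intro tendsto_intros)
  qed (use bound int_abs in auto)
  have intX: "integrable M (\<lambda>\<omega>. ?D \<omega> * real_of_int (X N \<omega>))"
  proof -
    have "integrable M (\<lambda>\<omega>. ?D \<omega> * (real_of_int (X N \<omega>) / real N))"
      by (rule Bochner_Integration.integrable_bound[OF int_abs])
        (use bound[of N] in \<open>auto elim!: eventually_mono\<close>)
    then have "integrable M (\<lambda>\<omega>. ?D \<omega> * (real_of_int (X N \<omega>) / real N) * real N)"
      by (rule integrable_mult_left)
    then show ?thesis using window_pos by simp
  qed
  \<comment> \<open>The contribution of the walk up to time \<open>N\<close>; it disappears after
    division by \<open>n\<close>.\<close>
  define c where "c = expectation (\<lambda>\<omega>. ?D \<omega> * real_of_int (X N \<omega>))"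
  have mean: "integrable M (\<lambda>\<omega>. ?D \<omega> * real_of_int (X n \<omega>)) \<and>
      expectation (\<lambda>\<omega>. ?D \<omega> * real_of_int (X n \<omega>)) = c + (real n - real N) * total_drift"
    if "N \<le> n" for n
    using that
  proof (induction n rule: dec_induct)
    case base
    then show ?case using intX by (simp add: c_def)
  next
    case (step n)
    have "(\<lambda>\<omega>. ?D \<omega> * real_of_int (X (Suc n) \<omega>)) =
        (\<lambda>\<omega>. ?D \<omega> * real_of_int (X n \<omega>) + ?D \<omega> * real_of_int (X (Suc n) \<omega> - X n \<omega>))"
      by (simp add: algebra_simps)
    with step.IH drift_expectation[OF step.hyps(1)] show ?case
      by (simp only: Bochner_Integration.integrable_add Bochner_Integration.integral_add)
        (simp add: algebra_simps)
  qed
  have "\<forall>\<^sub>F n in sequentially. (c - real N * total_drift) / real n + total_drift = ?e n"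
    using eventually_ge_at_top[of N] eventually_gt_at_top[of 0]
  proof eventually_elim
    case (elim n)
    have "?e n = expectation (\<lambda>\<omega>. ?D \<omega> * real_of_int (X n \<omega>)) / real n"
      by simp
    with mean[OF elim(1)] elim(2) show ?case by (simp add: field_simps)
  qed
  moreover have "(\<lambda>n. (c - real N * total_drift) / real n + total_drift) \<longlonglongrightarrow> 0 + total_drift"
    by (intro tendsto_add tendsto_const lim_const_over_n)
  ultimately have "?e \<longlonglongrightarrow> total_drift"
    by (simp add: tendsto_cong)
  from LIMSEQ_unique[OF this lim] have "total_drift = total_weight * s"
    using expectation_density by simp
  then show ?thesis using total_weight_pos by simp
qed

end

subsection \<open>Binomial coefficients and entropy\<close>


text \<open>The ratio of consecutive binomial probabilities with success probability
  \<open>i / N\<close>, scaled by \<open>N ^ N\<close> and cross-multiplied so as to stay in the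
  natural numbers.\<close>

lemma binomial_term_step:
  fixes N i j :: nat
  assumes "i \<le> N" "j < N"
  defines "c \<equiv> \<lambda>j. (N choose j) * i ^ j * (N - i) ^ (N - j)"
  shows "c (Suc j) * (Suc j * (N - i)) = c j * ((N - j) * i)"
proof -
  have 1: "Suc j * (N choose Suc j) = (N - j) * (N choose j)"
    using binomial_absorption[of j N] binomial_absorb_comp[of N j] by simp
  have 2: "(N - i) ^ (N - j) = (N - i) * (N - i) ^ (N - Suc j)"
    using assms by (metis Suc_diff_Suc power_Suc)
  have "c (Suc j) * (Suc j * (N - i)) =
      (Suc j * (N choose Suc j)) * (i * i ^ j) * ((N - i) * (N - i) ^ (N - Suc j))"
    by (simp add: c_def mult_ac del: mult_Suc binomial_Suc_Suc)
  also have "\<dots> = c j * ((N - j) * i)"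
    unfolding 1 2[symmetric] by (simp add: c_def mult_ac)
  finally show ?thesis .
qed

text \<open>The binomial law with mean \<open>i\<close> has its mode at \<open>i\<close>: by the
  ratio formula the terms increase up to \<open>i\<close> and decrease afterwards.\<close>

lemma binomial_term_mode:
  fixes N i j :: nat
  assumes "i \<le> N" "j \<le> N"
  shows "(N choose j) * i ^ j * (N - i) ^ (N - j) \<le> (N choose i) * i ^ i * (N - i) ^ (N - i)"
proof -
  define c where "c = (\<lambda>j. (N choose j) * i ^ j * (N - i) ^ (N - j))"
  have step: "c (Suc j) * (Suc j * (N - i)) = c j * ((N - j) * i)" if "j < N" for j
    unfolding c_def by (rule binomial_term_step[OF assms(1) that])
  have up: "c j \<le> c (Suc j)" if "j < i" for j
  \<comment> \<open>For \<open>i = N\<close> the factor \<open>N - i\<close> cannot be cancelled,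
    but then \<open>c j\<close> is zero for every \<open>j < N\<close>.\<close>
  proof (cases "i = N")
    case True
    then show ?thesis using that by (simp add: c_def power_0_left)
  next
    case False
    have "Suc j * (N - i) \<le> (N - j) * i"
      using that assms by (subst mult.commute) (intro mult_mono; simp)
    then have "c j * (Suc j * (N - i)) \<le> c (Suc j) * (Suc j * (N - i))"
      using step[of j] mult_le_mono2[of _ _ "c j"] that assms(1) by (metis order_less_le_trans)
    then show ?thesis using False assms by (simp add: mult_le_cancel2 del: mult_Suc)
  qed
  have down: "c (Suc j) \<le> c j" if "i \<le> j" "j < N" for j
  proof -
    have "(N - j) * i \<le> Suc j * (N - i)"
      using that by (subst mult.commute) (intro mult_mono; simp)
    then have "c (Suc j) * (Suc j * (N - i)) \<le> c j * (Suc j * (N - i))"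
      using step[of j] mult_le_mono2[of _ _ "c j"] that by metis
    then show ?thesis using that by (simp add: mult_le_cancel2 del: mult_Suc)
  qed
  have "c j \<le> c i"
  proof (cases "j \<le> i")
    case True
    then show ?thesis
      by (induction j rule: inc_induct) (auto intro: order_trans[OF up])
  next
    case False
    then have "i \<le> j" by simp
    from this assms(2) show ?thesis
      by (induction j rule: dec_induct) (auto intro: order_trans[OF down])
  qed
  then show ?thesis by (simp add: c_def)
qed

text \<open>At the endpoints the zero factors produce the usual convention that
  \<open>0 * ln 0\<close> is 0.\<close>

definition binary_entropy :: "real \<Rightarrow> real" where
  "binary_entropy x = - x * ln x - (1 - x) * ln (1 - x)"

text \<open>Stated as a product so that the convention \<open>0 ^ 0 = 1\<close> covers
  \<open>i = 0\<close> and \<open>i = N\<close>.\<close>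

lemma exp_binary_entropy:
  assumes "i \<le> N" "0 < N"
  shows "exp (real N * binary_entropy (real i / real N)) * (real i ^ i * real (N - i) ^ (N - i)) = real N ^ N"
proof -
  have *: "exp (- (real k * ln (real k / real N))) * real k ^ k = real N ^ k" for k
  proof (cases "k = 0")
    case False
    then have "exp (- (real k * ln (real k / real N))) = exp (real k * ln (real N / real k))"
      using assms by (simp add: ln_div algebra_simps)
    also have "\<dots> = (real N / real k) ^ k"
      using False assms by (subst exp_of_nat_mult) simp
    finally show ?thesis using False by (simp add: power_divide)
  qed auto
  have "1 - real i / real N = real (N - i) / real N"
    using assms by (simp add: field_simps of_nat_diff)
  then have "exp (real N * binary_entropy (real i / real N)) =
      exp (- (real i * ln (real i / real N))) * exp (- (real (N - i) * ln (real (N - i) / real N)))"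
    using assms by (simp add: binary_entropy_def exp_add[symmetric] right_diff_distrib)
  then have "exp (real N * binary_entropy (real i / real N)) * (real i ^ i * real (N - i) ^ (N - i)) =
      real N ^ i * real N ^ (N - i)"
    unfolding *[of i, symmetric] *[of "N - i", symmetric] by (simp only: mult_ac)
  then show ?thesis using assms by (simp flip: power_add)
qed

text \<open>Expanding \<open>(i + (N - i)) ^ N\<close> gives \<open>N + 1\<close> terms, of which
  the one at \<open>i\<close> is the largest. It therefore lies between
  \<open>N ^ N / (N + 1)\<close> and \<open>N ^ N\<close>, and dividing by \<open>d\<close> gives
  both bounds.\<close>

lemma binomial_entropy_bounds:
  assumes "i \<le> N" "0 < N"
  shows "real (N choose i) \<le> exp (real N * binary_entropy (real i / real N))"
    and "exp (real N * binary_entropy (real i / real N)) \<le> real (N + 1) * real (N choose i)"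
proof -
  define c where "c = (\<lambda>j. (N choose j) * i ^ j * (N - i) ^ (N - j))"
  define d where "d = real i ^ i * real (N - i) ^ (N - i)"
  have total: "N ^ N = (\<Sum>j\<le>N. c j)"
    using binomial_ring[of i "N - i" N] assms by (simp add: c_def)
  have ci: "real (c i) = real (N choose i) * d" by (simp add: c_def d_def)
  have d: "0 < d" using assms by (cases "i = N") (auto simp: d_def simp flip: of_nat_diff intro!: mult_pos_pos)
  have E: "exp (real N * binary_entropy (real i / real N)) * d = real (N ^ N)"
    using exp_binary_entropy[OF assms] by (simp add: d_def)
  have "c i \<le> N ^ N"
    unfolding total using assms by (intro member_le_sum) auto
  then have "real (N choose i) * d \<le> exp (real N * binary_entropy (real i / real N)) * d"
    unfolding E ci[symmetric] by (rule of_nat_mono)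
  then show "real (N choose i) \<le> exp (real N * binary_entropy (real i / real N))"
    using d by simp
  have "N ^ N \<le> (N + 1) * c i"
    unfolding total using sum_bounded_above[of "{..N}" c "c i"] binomial_term_mode[OF assms(1)]
    by (simp add: c_def)
  then have "real (N ^ N) \<le> real ((N + 1) * c i)"
    by (rule of_nat_mono)
  then have "exp (real N * binary_entropy (real i / real N)) * d \<le> real (N + 1) * real (N choose i) * d"
    unfolding E by (simp only: of_nat_mult ci mult.assoc)
  then show "exp (real N * binary_entropy (real i / real N)) \<le> real (N + 1) * real (N choose i)"
    using d by (simp only: mult_le_cancel_right_pos)
qed

section \<open>Continuity and derivative of the entropy\<close>

lemma continuous_on_xlnx: "continuous_on {0..} (\<lambda>x::real. x * ln x)"
proof -
  \<comment> \<open>Continuity at 0 is reduced to the decay of \<open>ln y / y\<close> at infinity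
    by substituting \<open>y = inverse x\<close>.\<close>
  have "((\<lambda>x::real. - (ln (inverse x) / inverse x)) \<longlongrightarrow> - 0) (at_right 0)"
    by (intro tendsto_minus filterlim_compose[OF ln_x_over_x_tendsto_0 filterlim_inverse_at_top_right])
  moreover have "\<forall>\<^sub>F x::real in at_right 0. - (ln (inverse x) / inverse x) = x * ln x"
    using eventually_at_right_less[of 0] by eventually_elim (simp add: ln_inverse divide_inverse)
  ultimately have "((\<lambda>x::real. x * ln x) \<longlongrightarrow> 0) (at_right 0)"
    by (simp add: tendsto_cong)
  moreover have "at (0::real) within {0..} = at_right 0"
  proof -
    have "{0..} - {0} = {0<..} - {0::real}" by auto
    then show ?thesis by (simp add: at_within_def)
  qed
  ultimately have "continuous (at 0 within {0..}) (\<lambda>x::real. x * ln x)"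
    by (simp add: continuous_within)
  moreover have "continuous (at x within {0..}) (\<lambda>x::real. x * ln x)" if "0 < x" for x :: real
    using that by (intro continuous_intros) auto
  ultimately show ?thesis
    unfolding continuous_on_eq_continuous_within
    by (metis atLeast_iff order_le_less)
qed

lemma continuous_on_binary_entropy: "continuous_on {0..1} binary_entropy"
proof -
  have "continuous_on {0..1} (\<lambda>x::real. (1 - x) * ln (1 - x))"
    by (rule continuous_on_compose2[OF continuous_on_xlnx]) (auto intro!: continuous_intros)
  moreover have "continuous_on {0..1} (\<lambda>x::real. x * ln x)"
    by (rule continuous_on_subset[OF continuous_on_xlnx]) auto
  ultimately have "continuous_on {0..1} (\<lambda>x::real. - (x * ln x) - (1 - x) * ln (1 - x))"
    by (intro continuous_on_diff continuous_on_minus)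
  then show ?thesis by (simp add: binary_entropy_def[abs_def])
qed

lemma DERIV_binary_entropy:
  assumes "0 < x" "x < 1"
  shows "(binary_entropy has_real_derivative - ln (x / (1 - x))) (at x)"
proof -
  have "((\<lambda>x. x * ln x) has_real_derivative ln y + 1) (at y)" if "0 < y" for y :: real
    using DERIV_mult[OF DERIV_ident DERIV_ln_divide[OF that]] that by simp
  note D = this
  have "((\<lambda>x. (1 - x) * ln (1 - x)) has_real_derivative (ln (1 - x) + 1) * (0 - 1)) (at x)"
    by (rule DERIV_chain2[OF D DERIV_diff[OF DERIV_const DERIV_ident]]) (use assms in simp)
  from DERIV_diff[OF DERIV_minus[OF D[OF assms(1)]] this]
  show ?thesis
    using assms unfolding binary_entropy_def[abs_def] by (simp add: ln_div)
qed

subsection \<open>The potential and concentration of the stationary law\<close>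

lemma logit_less_logit_iff:
  fixes a b :: real
  assumes "0 < a" "a < 1" "0 < b" "b < 1"
  shows "ln (a / (1 - a)) < ln (b / (1 - b)) \<longleftrightarrow> a < b"
proof -
  have "ln (a / (1 - a)) < ln (b / (1 - b)) \<longleftrightarrow> a / (1 - a) < b / (1 - b)"
    using assms by (intro ln_less_cancel_iff) auto
  also have "\<dots> \<longleftrightarrow> a < b"
    using assms by (simp add: field_simps)
  finally show ?thesis .
qed

locale excitation =
  fixes G :: "real \<Rightarrow> real"
  assumes continuous_G: "continuous_on {0..1} G"
    and mono_G: "mono_on {0..1} G"
    and G_bounds: "\<And>x. x \<in> {0..1} \<Longrightarrow> 0 < G x \<and> G x < 1"
begin

definition logit_G :: "real \<Rightarrow> real" where
  "logit_G x = ln (G x / (1 - G x))"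

lemma continuous_logit_G: "continuous_on {0..1} logit_G"
  unfolding logit_G_def
proof (intro continuous_intros continuous_G ballI)
  fix x :: real assume "x \<in> {0..1}"
  from G_bounds[OF this] show "1 - G x \<noteq> 0" "G x / (1 - G x) \<noteq> 0" by auto
qed

lemma logit_G_mono:
  assumes "0 \<le> x" "x \<le> y" "y \<le> 1"
  shows "logit_G x \<le> logit_G y"
proof -
  have "G x \<le> G y" using mono_onD[OF mono_G] assms by auto
  then show ?thesis
    using logit_less_logit_iff[of "G y" "G x"] G_bounds[of x] G_bounds[of y] assms
    by (auto simp: logit_G_def not_less[symmetric])
qed

lemma potential_eq: "potential G x = integral {0..x} logit_G + binary_entropy x"
  by (simp add: potential_def binary_entropy_def logit_G_def[abs_def])

text \<open>Continuity up to the endpoints makes compactness available, although the maximum is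
  sought on the open interval.\<close>

lemma continuous_potential: "continuous_on {0..1} (potential G)"
  unfolding potential_eq[abs_def]
  by (intro continuous_on_add continuous_on_binary_entropy indefinite_integral_continuous_1
      integrable_continuous_interval continuous_logit_G)

lemma DERIV_potential:
  assumes "0 < x" "x < 1"
  shows "(potential G has_real_derivative logit_G x - ln (x / (1 - x))) (at x)"
proof -
  have "((\<lambda>x. integral {0..x} logit_G) has_real_derivative logit_G x) (at x within {0..1})"
    using assms by (intro integral_has_real_derivative continuous_logit_G) auto
  then have "((\<lambda>x. integral {0..x} logit_G) has_real_derivative logit_G x) (at x)"
    using assms by (simp add: at_within_Icc_at)
  from DERIV_add[OF this DERIV_binary_entropy[OF assms]] show ?thesis
    by (simp add: potential_eq[abs_def])
qed

text \<open>On \<open>(0, G 0)\<close> monotonicity gives \<open>x < G 0 \<le> G x\<close>, so the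
  derivative, a difference of logits, is positive. This excludes 0 as a maximizer;
  \<open>potential_1_less\<close> is the mirror image.\<close>

lemma potential_0_less: "potential G 0 < potential G (G 0)"
proof (rule DERIV_pos_imp_increasing_open[where f = "potential G" and a = 0 and b = "G 0"])
  fix x assume x: "0 < x" "x < G 0"
  have "ln (x / (1 - x)) < logit_G 0"
    unfolding logit_G_def using x G_bounds[of 0] by (subst logit_less_logit_iff) auto
  also have "\<dots> \<le> logit_G x"
    using x G_bounds[of 0] by (intro logit_G_mono) auto
  finally show "\<exists>y. (potential G has_real_derivative y) (at x) \<and> 0 < y"
    using DERIV_potential[of x] x G_bounds[of 0] by force
qed (use G_bounds[of 0] in \<open>auto intro: continuous_on_subset[OF continuous_potential]\<close>)

lemma potential_1_less: "potential G 1 < potential G (G 1)"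
proof (rule DERIV_neg_imp_decreasing_open[where f = "potential G" and a = "G 1" and b = 1])
  fix x assume x: "G 1 < x" "x < 1"
  have "logit_G x \<le> logit_G 1"
    using x G_bounds[of 1] by (intro logit_G_mono) auto
  also have "\<dots> < ln (x / (1 - x))"
    unfolding logit_G_def using x G_bounds[of 1] by (subst logit_less_logit_iff) auto
  finally show "\<exists>y. (potential G has_real_derivative y) (at x) \<and> y < 0"
    using DERIV_potential[of x] x G_bounds[of 1] by force
qed (use G_bounds[of 1] in \<open>auto intro: continuous_on_subset[OF continuous_potential]\<close>)

text \<open>The endpoints are beaten by the interior points \<open>G 0\<close> and
  \<open>G 1\<close>, so maximality over the open and over the closed interval agree.\<close>

lemma attains_max_at_iff:
  "attains_max_at (potential G) p \<longleftrightarrow>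
    p \<in> {0<..<1} \<and> (\<forall>q\<in>{0..1}. potential G q \<le> potential G p)"
proof -
  have *: "potential G q \<le> potential G p"
    if p: "\<forall>q\<in>{0<..<1}. potential G q \<le> potential G p" and q: "q \<in> {0..1}" for q
  proof -
    have "potential G (G 0) \<le> potential G p" "potential G (G 1) \<le> potential G p"
      using p G_bounds[of 0] G_bounds[of 1] by auto
    with p q potential_0_less potential_1_less show ?thesis
      by (cases "q = 0"; cases "q = 1") auto
  qed
  have "attains_max_at (potential G) p \<longleftrightarrow>
      p \<in> {0<..<1} \<and> (\<forall>q\<in>{0<..<1}. potential G q \<le> potential G p)"
    unfolding attains_max_at_def is_arg_max_def Ball_def not_less[symmetric] by blast
  also have "\<dots> \<longleftrightarrow> p \<in> {0<..<1} \<and> (\<forall>q\<in>{0..1}. potential G q \<le> potential G p)"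
    using * by (meson atLeastAtMost_iff greaterThanLessThan_iff less_imp_le)
  finally show ?thesis .
qed

lemma potential_attains_max: "\<exists>p. attains_max_at (potential G) p"
proof -
  obtain p where p: "p \<in> {0..1}" "\<forall>q\<in>{0..1}. potential G q \<le> potential G p"
    using continuous_attains_sup[OF compact_Icc _ continuous_potential] by auto
  have "G 0 \<in> {0..1}" "G 1 \<in> {0..1}"
    using G_bounds[of 0] G_bounds[of 1] by auto
  with p(2) potential_0_less potential_1_less have "p \<noteq> 0" "p \<noteq> 1"
    by (auto simp: not_le[symmetric])
  with p(1) have "p \<in> {0<..<1}" by auto
  with p(2) have "attains_max_at (potential G) p" by (simp add: attains_max_at_iff)
  then show ?thesis ..
qed

text \<open>At an interior maximum the derivative vanishes, so \<open>G p\<close> and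
  \<open>p\<close> have equal logits, and the logit is injective.\<close>

lemma max_imp_fixed_point:
  assumes "attains_max_at (potential G) p"
  shows "G p = p"
proof -
  have p: "0 < p" "p < 1" and max: "\<forall>q\<in>{0..1}. potential G q \<le> potential G p"
    using assms unfolding attains_max_at_iff by auto
  have "logit_G p - ln (p / (1 - p)) = 0"
    using p max by (intro DERIV_local_max[OF DERIV_potential[OF p], of "min p (1 - p)"])
      (auto simp: abs_if split: if_splits)
  then show ?thesis
    using logit_less_logit_iff[of "G p" p] logit_less_logit_iff[of p "G p"] p G_bounds[of p]
    by (simp add: logit_G_def)
qed

text \<open>For a monotone integrand the error of the left Riemann sum telescopes. After scaling by
  \<open>N\<close> it is still at most \<open>logit_G 1 - logit_G 0\<close>, uniformly in
  \<open>i\<close> and \<open>N\<close>.\<close>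

lemma riemann_sum_bounds:
  assumes "i \<le> N" "0 < N"
  shows "(\<Sum>k<i. logit_G (real k / real N)) \<le> real N * integral {0..real i / real N} logit_G \<and>
    real N * integral {0..real i / real N} logit_G \<le>
      (\<Sum>k<i. logit_G (real k / real N)) + logit_G (real i / real N) - logit_G 0"
  using assms(1)
proof (induction i)
  case 0
  then show ?case by simp
next
  case (Suc i)
  define a b where "a = real i / real N" and "b = real (Suc i) / real N"
  have ab: "0 \<le> a" "a \<le> b" "b \<le> 1" "b - a = 1 / real N"
    using Suc.prems assms(2) by (auto simp: a_def b_def field_simps)
  have int: "logit_G integrable_on {c..d}" if "0 \<le> c" "d \<le> 1" for c d
    by (rule integrable_continuous_interval)
      (use that in \<open>auto intro: continuous_on_subset[OF continuous_logit_G]\<close>)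
  have "integral {0..b} logit_G = integral {0..a} logit_G + integral {a..b} logit_G"
    using ab by (intro Henstock_Kurzweil_Integration.integral_combine[symmetric] int) auto
  moreover have const: "integral {a..b} (\<lambda>_. c) = c / real N" for c
    using ab by simp
  have "integral {a..b} (\<lambda>_. logit_G a) \<le> integral {a..b} logit_G"
    using ab by (intro integral_le int logit_G_mono) auto
  moreover have "integral {a..b} logit_G \<le> integral {a..b} (\<lambda>_. logit_G b)"
    using ab by (intro integral_le int logit_G_mono) auto
  ultimately have "real N * integral {0..a} logit_G + logit_G a \<le> real N * integral {0..b} logit_G"
    "real N * integral {0..b} logit_G \<le> real N * integral {0..a} logit_G + logit_G b"
    using assms(2) unfolding const by (auto simp: field_simps)
  with Suc show ?case by (simp add: a_def b_def)
qed

section \<open>Exponential estimates for the stationary weights\<close>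

definition state_weight :: "nat \<Rightarrow> nat \<Rightarrow> real" where
  "state_weight N i = real (N choose i) * stationary_weight (\<lambda>i. G (real i / real N)) i"

lemma unit_fraction: "i \<le> N \<Longrightarrow> real i / real N \<in> {0..1}"
  by (cases "N = 0") auto

lemma stationary_weight_eq_exp:
  assumes "i \<le> N"
  shows "stationary_weight (\<lambda>i. G (real i / real N)) i =
    exp (\<Sum>k<i. logit_G (real k / real N)) / (1 - G (real i / real N))"
proof -
  have "exp (logit_G (real k / real N)) = G (real k / real N) / (1 - G (real k / real N))"
    if "k \<le> N" for k
    using G_bounds[OF unit_fraction[OF that]] by (simp add: logit_G_def)
  then show ?thesis
    using assms by (simp add: stationary_weight_def exp_sum)
qed

lemma state_weight_pos: "i \<le> N \<Longrightarrow> 0 < state_weight N i"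
  unfolding state_weight_def
  using G_bounds[OF unit_fraction] by (intro mult_pos_pos stationary_weight_pos) auto

text \<open>The entropy bound and the Riemann sum bound add up to the potential in the exponent;
  monotonicity of \<open>G\<close> bounds the remaining factor.\<close>

lemma state_weight_upper:
  assumes "i \<le> N" "0 < N"
  shows "state_weight N i \<le> exp (real N * potential G (real i / real N)) / (1 - G 1)"
proof -
  let ?x = "real i / real N"
  have x: "?x \<in> {0..1}" by (rule unit_fraction[OF assms(1)])
  have "G ?x \<le> G 1" using mono_onD[OF mono_G x, of 1] x by auto
  then have "1 / (1 - G ?x) \<le> 1 / (1 - G 1)"
    using G_bounds[of 1] G_bounds[OF x] by (intro divide_left_mono) auto
  moreover have "exp (\<Sum>k<i. logit_G (real k / real N)) \<le> exp (real N * integral {0..?x} logit_G)"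
    using riemann_sum_bounds[OF assms] by simp
  moreover have "real (N choose i) \<le> exp (real N * binary_entropy ?x)"
    by (rule binomial_entropy_bounds[OF assms])
  ultimately have "real (N choose i) * (exp (\<Sum>k<i. logit_G (real k / real N)) * (1 / (1 - G ?x)))
      \<le> exp (real N * binary_entropy ?x) * (exp (real N * integral {0..?x} logit_G) * (1 / (1 - G 1)))"
    using G_bounds[OF x] by (intro mult_mono) auto
  also have "\<dots> = exp (real N * potential G ?x) / (1 - G 1)"
    by (simp add: potential_eq distrib_left exp_add)
  finally show ?thesis
    by (simp add: state_weight_def stationary_weight_eq_exp[OF assms(1)])
qed

text \<open>The loss \<open>1 / (N + 1)\<close> comes from the binomial coefficient, and the
  constant exponential from the Riemann sum error.\<close>

lemma state_weight_lower:
  assumes "i \<le> N" "0 < N"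
  shows "exp (real N * potential G (real i / real N)) * exp (logit_G 0 - logit_G 1) / real (N + 1)
    \<le> state_weight N i"
proof -
  let ?x = "real i / real N"
  have x: "?x \<in> {0..1}" by (rule unit_fraction[OF assms(1)])
  have "1 \<le> 1 / (1 - G ?x)" using G_bounds[OF x] by simp
  moreover have "exp (real N * integral {0..?x} logit_G + (logit_G 0 - logit_G 1))
      \<le> exp (\<Sum>k<i. logit_G (real k / real N))"
    using riemann_sum_bounds[OF assms] logit_G_mono[of ?x 1] x by simp
  moreover have "exp (real N * binary_entropy ?x) / real (N + 1) \<le> real (N choose i)"
    using binomial_entropy_bounds(2)[OF assms] by (simp add: field_simps)
  ultimately have "exp (real N * binary_entropy ?x) / real (N + 1) *
      (exp (real N * integral {0..?x} logit_G + (logit_G 0 - logit_G 1)) * 1)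
      \<le> real (N choose i) * (exp (\<Sum>k<i. logit_G (real k / real N)) * (1 / (1 - G ?x)))"
    by (intro mult_mono) auto
  moreover have "exp (real N * binary_entropy ?x) / real (N + 1) *
      (exp (real N * integral {0..?x} logit_G + (logit_G 0 - logit_G 1)) * 1) =
      exp (real N * potential G ?x) * exp (logit_G 0 - logit_G 1) / real (N + 1)"
    by (simp add: potential_eq distrib_left exp_add)
  ultimately show ?thesis
    by (simp add: state_weight_def stationary_weight_eq_exp[OF assms(1)])
qed

text \<open>Laplace's method: states away from \<open>p\<close> have exponentially small relative
  weight, and near \<open>p\<close> continuity keeps the drift close to
  \<open>2 * G p - 1 = 2 * p - 1\<close>.\<close>

lemma drift_limit:
  assumes max: "attains_max_at (potential G) p"
    and unique: "\<And>q. attains_max_at (potential G) q \<Longrightarrow> q = p"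
  shows "(\<lambda>N. (\<Sum>i\<le>N. state_weight N i * (2 * G (real i / real N) - 1)) /
      (\<Sum>i\<le>N. state_weight N i)) \<longlonglongrightarrow> 2 * p - 1"
proof (rule LIMSEQ_I)
  fix e :: real assume e: "0 < e"
  have p: "0 < p" "p < 1" and pmax: "\<And>q. q \<in> {0..1} \<Longrightarrow> potential G q \<le> potential G p"
    using max unfolding attains_max_at_iff by auto
  have Gp: "G p = p" by (rule max_imp_fixed_point[OF max])
  obtain d where d: "0 < d" "\<And>x. x \<in> {0..1} \<Longrightarrow> \<bar>x - p\<bar> < d \<Longrightarrow> \<bar>G x - p\<bar> < e / 4"
    using continuous_G[unfolded continuous_on_iff, rule_format, of p "e / 4"] p e Gp
    by (auto simp: dist_real_def)
  define U where "U = {0..1} \<inter> {x. d \<le> \<bar>x - p\<bar>}"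
  \<comment> \<open>The gap is \<open>2 * \<eta>\<close>: one \<open>\<eta>\<close> pays for
    replacing \<open>p\<close> by a nearby grid point, the other remains as exponential
    decay.\<close>
  obtain \<eta> where \<eta>: "0 < \<eta>" "\<And>x. x \<in> U \<Longrightarrow> potential G x \<le> potential G p - 2 * \<eta>"
  proof (cases "U = {}")
    case True
    then show thesis using that[of 1] by auto
  next
    case False
    have "compact U"
      unfolding U_def by (intro compact_Int_closed compact_Icc closed_Collect_le continuous_intros)
    moreover have "continuous_on U (potential G)"
      by (rule continuous_on_subset[OF continuous_potential]) (auto simp: U_def)
    ultimately obtain u where u: "u \<in> U" "\<And>x. x \<in> U \<Longrightarrow> potential G x \<le> potential G u"
      using continuous_attains_sup[OF _ False] by blast
    have "potential G u < potential G p"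
    \<comment> \<open>Otherwise \<open>u\<close> would be a second maximizer, at distance at least
      \<open>d\<close> from \<open>p\<close>.\<close>
    proof (rule ccontr)
      assume "\<not> potential G u < potential G p"
      with pmax have *: "\<And>q. q \<in> {0..1} \<Longrightarrow> potential G q \<le> potential G u"
        by (meson not_less order_trans)
      have "G 0 \<in> {0..1}" "G 1 \<in> {0..1}"
        using G_bounds[of 0] G_bounds[of 1] by auto
      with * potential_0_less potential_1_less have "u \<noteq> 0" "u \<noteq> 1"
        by (auto simp: not_le[symmetric])
      with u(1) have "u \<in> {0<..<1}" by (auto simp: U_def)
      with * have "attains_max_at (potential G) u" by (simp add: attains_max_at_iff)
      then have "u = p" by (rule unique)
      with u(1) d(1) show False by (simp add: U_def)
    qed
    then show thesis
      using u(2) by (intro that[of "(potential G p - potential G u) / 2"]) (auto simp: field_simps)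
  qed
  \<comment> \<open>The quotient of the constants in \<open>state_weight_upper\<close> and
    \<open>state_weight_lower\<close>.\<close>
  define C where "C = 1 / (1 - G 1) / exp (logit_G 0 - logit_G 1)"
  have C: "0 < C" using G_bounds[of 1] by (simp add: C_def)
  \<comment> \<open>\<open>idx N / N\<close> is the grid point just below \<open>p\<close>; its
    weight alone bounds the total weight from below.\<close>
  define idx where "idx = (\<lambda>N. nat \<lfloor>real N * p\<rfloor>)"
  have idx_le: "idx N \<le> N" for N
  proof -
    have "real N * p \<le> real N" using p by (simp add: mult_left_le)
    then show ?thesis unfolding idx_def by linarith
  qed
  have idx_lim: "(\<lambda>N. real (idx N) / real N) \<longlonglongrightarrow> p"
  proof (rule tendsto_sandwich)
    show "(\<lambda>N. p - 1 / real N) \<longlonglongrightarrow> p"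
      using tendsto_diff[OF tendsto_const lim_const_over_n[of 1]] by simp
    show "\<forall>\<^sub>F N in sequentially. p - 1 / real N \<le> real (idx N) / real N"
      using eventually_gt_at_top[of 0]
    proof eventually_elim
      case (elim N)
      have "0 \<le> real N * p" using p by simp
      then have "real N * p - 1 \<le> real (idx N)" unfolding idx_def by linarith
      then have "(real N * p - 1) / real N \<le> real (idx N) / real N"
        by (rule divide_right_mono) simp
      with elim show ?case by (simp add: diff_divide_distrib)
    qed
    show "\<forall>\<^sub>F N in sequentially. real (idx N) / real N \<le> p"
      using eventually_gt_at_top[of 0]
    proof eventually_elim
      case (elim N)
      have "0 \<le> real N * p" using p by simp
      then have "real (idx N) \<le> real N * p" unfolding idx_def by linarith
      with elim show ?case by (simp add: field_simps)
    qed
  qed simp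
  have "(\<lambda>N. potential G (real (idx N) / real N)) \<longlonglongrightarrow> potential G p"
    using p idx_le by (intro continuous_on_tendsto_compose[OF continuous_potential idx_lim])
      (auto intro!: always_eventually unit_fraction[simplified])
  then have near: "\<forall>\<^sub>F N in sequentially. potential G p - \<eta> < potential G (real (idx N) / real N)"
    using \<eta>(1) by (intro order_tendstoD) auto
  \<comment> \<open>The error \<open>(N + 1)\<^sup>2 * exp (- \<eta> * N)\<close> is written as a
    square, so that the limit of \<open>n * x ^ n\<close> suffices.\<close>
  have "(\<lambda>N. C * ((real N * exp (- \<eta> / 2) ^ N + exp (- \<eta> / 2) ^ N)\<^sup>2)) \<longlonglongrightarrow> C * ((0 + 0)\<^sup>2)"
    using \<eta>(1) powser_times_n_limit_0[of "exp (- \<eta> / 2)"]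
    by (intro tendsto_intros LIMSEQ_power_zero) auto
  then have small: "\<forall>\<^sub>F N in sequentially. C * ((real N * exp (- \<eta> / 2) ^ N + exp (- \<eta> / 2) ^ N)\<^sup>2) < e / 8"
    using e by (intro order_tendstoD) auto
  have "\<forall>\<^sub>F N in sequentially. norm ((\<Sum>i\<le>N. state_weight N i * (2 * G (real i / real N) - 1)) /
      (\<Sum>i\<le>N. state_weight N i) - (2 * p - 1)) < e"
    using near small eventually_gt_at_top[of 0]
  proof eventually_elim
    case (elim N)
    define W where "W = (\<Sum>i\<le>N. state_weight N i)"
    define E where "E = exp (real N * (potential G p - \<eta>))"
    have W: "0 < W" unfolding W_def by (intro sum_pos) (auto intro: state_weight_pos)
    have W_lower: "E * exp (logit_G 0 - logit_G 1) / real (N + 1) \<le> W"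
    proof -
      have "E * exp (logit_G 0 - logit_G 1) / real (N + 1) \<le>
          exp (real N * potential G (real (idx N) / real N)) * exp (logit_G 0 - logit_G 1) / real (N + 1)"
        using elim unfolding E_def by (intro divide_right_mono mult_right_mono) auto
      also have "\<dots> \<le> state_weight N (idx N)"
        using idx_le elim by (intro state_weight_lower)
      also have "\<dots> \<le> W"
        unfolding W_def using idx_le by (intro member_le_sum) (auto intro: less_imp_le state_weight_pos)
      finally show ?thesis .
    qed
    define far where "far = {i. i \<le> N \<and> real i / real N \<in> U}"
    have far_sum: "(\<Sum>i\<in>far. state_weight N i) \<le> e / 8 * W"
    proof -
      have card: "card far \<le> N + 1"
        using card_mono[of "{..N}" far] by (auto simp: far_def)
      have "(\<Sum>i\<in>far. state_weight N i) \<le> real (card far) * (E * exp (- \<eta>) ^ N / (1 - G 1))"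
      proof (rule sum_bounded_above)
        fix i assume i: "i \<in> far"
        then have "state_weight N i \<le> exp (real N * potential G (real i / real N)) / (1 - G 1)"
          using elim by (intro state_weight_upper) (auto simp: far_def)
        also have "\<dots> \<le> exp (real N * (potential G p - 2 * \<eta>)) / (1 - G 1)"
        proof (rule divide_right_mono)
          have "real N * potential G (real i / real N) \<le> real N * (potential G p - 2 * \<eta>)"
            using i \<eta>(2) by (intro mult_left_mono) (auto simp: far_def)
          then show "exp (real N * potential G (real i / real N)) \<le> exp (real N * (potential G p - 2 * \<eta>))"
            by simp
        qed (use G_bounds[of 1] in simp)
        also have "exp (real N * (potential G p - 2 * \<eta>)) = E * exp (- \<eta>) ^ N"
        proof -
          have "real N * (potential G p - 2 * \<eta>) = real N * (potential G p - \<eta>) + real N * (- \<eta>)"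
            by (simp add: algebra_simps)
          then show ?thesis by (simp only: E_def exp_add exp_of_nat_mult)
        qed
        finally show "state_weight N i \<le> E * exp (- \<eta>) ^ N / (1 - G 1)" .
      qed
      also have "\<dots> \<le> real (N + 1) * (E * exp (- \<eta>) ^ N / (1 - G 1))"
        using card G_bounds[of 1] by (intro mult_right_mono) (auto simp: E_def)
      \<comment> \<open>The lower bound for \<open>W\<close> is split off, which costs a second
        factor \<open>N + 1\<close>.\<close>
      also have "\<dots> = (real (N + 1))\<^sup>2 * exp (- \<eta>) ^ N * C *
          (E * exp (logit_G 0 - logit_G 1) / real (N + 1))"
        by (simp add: C_def power2_eq_square)
      also have "\<dots> \<le> (real (N + 1))\<^sup>2 * exp (- \<eta>) ^ N * C * W"
        using W_lower C by (intro mult_left_mono) auto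
      also have "(real (N + 1))\<^sup>2 * exp (- \<eta>) ^ N * C =
          C * ((real N * exp (- \<eta> / 2) ^ N + exp (- \<eta> / 2) ^ N)\<^sup>2)"
      proof -
        have "exp (- \<eta>) ^ N = (exp (- \<eta> / 2) ^ N)\<^sup>2"
        proof -
          have "exp (- \<eta>) = (exp (- \<eta> / 2))\<^sup>2"
            by (simp add: power2_eq_square flip: exp_add)
          then show ?thesis by (metis power_mult mult.commute)
        qed
        moreover have "real N * exp (- \<eta> / 2) ^ N + exp (- \<eta> / 2) ^ N =
            real (N + 1) * exp (- \<eta> / 2) ^ N"
          by (simp add: algebra_simps)
        ultimately show ?thesis by (simp only: power_mult_distrib mult_ac)
      qed
      also have "\<dots> * W \<le> e / 8 * W"
        using elim W by (intro mult_right_mono) auto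
      finally show ?thesis .
    qed
    \<comment> \<open>Near \<open>p\<close> the deviation is at most \<open>e / 4\<close>; on far
      states it is below 1 and is charged to their whole weight.\<close>
    have pointwise: "state_weight N i * \<bar>G (real i / real N) - p\<bar> \<le>
        state_weight N i * (e / 4) + (if i \<in> far then state_weight N i else 0)"
      if "i \<le> N" for i
    proof (cases "i \<in> far")
      case True
      have "\<bar>G (real i / real N) - p\<bar> \<le> e / 4 + 1"
        using G_bounds[OF unit_fraction[OF that]] p e by auto
      then have "state_weight N i * \<bar>G (real i / real N) - p\<bar> \<le> state_weight N i * (e / 4 + 1)"
        using state_weight_pos[OF that] by (intro mult_left_mono) auto
      with True show ?thesis by (simp add: algebra_simps)
    next
      case False
      then have "\<bar>G (real i / real N) - p\<bar> \<le> e / 4"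
        using d(2)[OF unit_fraction[OF that]] unit_fraction[OF that] that
        by (auto simp: far_def U_def not_le)
      with False show ?thesis
        using state_weight_pos[OF that] by (simp add: mult_left_mono)
    qed
    have "\<bar>(\<Sum>i\<le>N. state_weight N i * (G (real i / real N) - p))\<bar> \<le>
        (\<Sum>i\<le>N. \<bar>state_weight N i * (G (real i / real N) - p)\<bar>)"
      by (rule sum_abs)
    also have "\<dots> = (\<Sum>i\<le>N. state_weight N i * \<bar>G (real i / real N) - p\<bar>)"
      using state_weight_pos by (intro sum.cong) (auto simp: abs_mult abs_of_pos)
    also have "\<dots> \<le> (\<Sum>i\<le>N. state_weight N i * (e / 4) + (if i \<in> far then state_weight N i else 0))"
      using pointwise by (intro sum_mono) auto
    also have "\<dots> = W * (e / 4) + (\<Sum>i\<in>far. state_weight N i)"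
    proof -
      have "{..N} \<inter> far = far" by (auto simp: far_def)
      then have "(\<Sum>i\<le>N. if i \<in> far then state_weight N i else 0) = (\<Sum>i\<in>far. state_weight N i)"
        using sum.inter_restrict[of "{..N}" "state_weight N" far] by simp
      then show ?thesis by (simp only: sum.distrib W_def sum_distrib_right)
    qed
    \<comment> \<open>The shares \<open>e / 4\<close> and \<open>e / 8\<close> leave room below
      \<open>e / 2\<close>; the drift \<open>2 * G - 1\<close> then doubles the bound to
      \<open>e\<close>.\<close>
    also have "\<dots> < e / 2 * W"
      using far_sum mult_pos_pos[OF e W] by (simp add: field_simps)
    finally have main: "\<bar>(\<Sum>i\<le>N. state_weight N i * (G (real i / real N) - p))\<bar> < e / 2 * W" .
    have "(\<Sum>i\<le>N. state_weight N i * (2 * G (real i / real N) - 1)) - (2 * p - 1) * W =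
        2 * (\<Sum>i\<le>N. state_weight N i * (G (real i / real N) - p))"
      unfolding W_def sum_distrib_left sum_subtractf[symmetric]
      by (intro sum.cong) (auto simp: algebra_simps)
    then have "(\<Sum>i\<le>N. state_weight N i * (2 * G (real i / real N) - 1)) / W - (2 * p - 1) =
        2 * (\<Sum>i\<le>N. state_weight N i * (G (real i / real N) - p)) / W"
      using W by (simp add: field_simps)
    moreover have "\<bar>2 * (\<Sum>i\<le>N. state_weight N i * (G (real i / real N) - p)) / W\<bar> < e"
      using main W by (simp add: abs_mult divide_less_eq)
    ultimately show ?case by (simp add: W_def)
  qed
  then show "\<exists>N0. \<forall>N\<ge>N0. norm ((\<Sum>i\<le>N. state_weight N i * (2 * G (real i / real N) - 1)) /
      (\<Sum>i\<le>N. state_weight N i) - (2 * p - 1)) < e"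
    by (simp add: eventually_sequentially)
qed

section \<open>The speed as a ratio of weighted sums, and its limit\<close>

lemma speed_eq:
  assumes "recent_history_walk M N (\<lambda>i. G (real i / real N)) x0 X" "1 \<le> N" "has_speed M X s"
  shows "s = (\<Sum>i\<le>N. state_weight N i * (2 * G (real i / real N) - 1)) / (\<Sum>i\<le>N. state_weight N i)"
proof -
  interpret elliptic_recent_history_walk M N "\<lambda>i. G (real i / real N)" x0 X
  proof (intro elliptic_recent_history_walk.intro elliptic_recent_history_walk_axioms.intro)
    show "0 < G (real i / real N) \<and> G (real i / real N) < 1" if "i \<le> N" for i
      by (rule G_bounds[OF unit_fraction[OF that]])
  qed (fact assms)+
  show ?thesis
    using speed_formula[OF assms(3)]
    by (simp add: total_drift_def total_weight_def state_weight_def mult.assoc)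
qed

end

theorem theorem6:
  fixes G :: "real \<Rightarrow> real"
  assumes "continuous_on {0..1} G"
    and "mono_on {0..1} G"
    and "\<And>x. x \<in> {0..1} \<Longrightarrow> 0 < G x \<and> G x < 1"
  shows "(\<exists>p. attains_max_at (potential G) p) \<and>
    (\<forall>p. attains_max_at (potential G) p \<longrightarrow> G p = p) \<and>
    ((\<exists>!p. p \<in> {0<..<1} \<and> G p = p) \<longrightarrow> (\<exists>!p. attains_max_at (potential G) p)) \<and>
    (\<forall>(M :: nat \<Rightarrow> 'a measure) X x0 s pstar.
      (\<forall>N\<ge>1. recent_history_walk (M N) N (\<lambda>i. G (real i / real N)) (x0 N) (X N) \<and>
              has_speed (M N) (X N) (s N)) \<and>
      attains_max_at (potential G) pstar \<and>
      (\<forall>q. attains_max_at (potential G) q \<longrightarrow> q = pstar) \<longrightarrow>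
      s \<longlonglongrightarrow> 2 * pstar - 1)"
proof -
  interpret excitation G
    using assms by unfold_locales auto
  show ?thesis
  proof (intro conjI allI impI)
    show "\<exists>p. attains_max_at (potential G) p"
      by (rule potential_attains_max)
    show "G p = p" if "attains_max_at (potential G) p" for p
      by (rule max_imp_fixed_point[OF that])
    show "\<exists>!p. attains_max_at (potential G) p" if "\<exists>!p. p \<in> {0<..<1} \<and> G p = p"
      \<comment> \<open>A maximizer exists, and all maximizers are fixed points in the open
        interval, of which there is only one.\<close>
      using that potential_attains_max max_imp_fixed_point attains_max_at_iff by metis
    fix M :: "nat \<Rightarrow> 'a measure" and X x0 s pstar
    assume *: "(\<forall>N\<ge>1. recent_history_walk (M N) N (\<lambda>i. G (real i / real N)) (x0 N) (X N) \<and>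
        has_speed (M N) (X N) (s N)) \<and>
      attains_max_at (potential G) pstar \<and>
      (\<forall>q. attains_max_at (potential G) q \<longrightarrow> q = pstar)"
    have "(\<Sum>i\<le>N. state_weight N i * (2 * G (real i / real N) - 1)) /
        (\<Sum>i\<le>N. state_weight N i) = s N" if "1 \<le> N" for N
      by (rule speed_eq[symmetric, of "M N" N "x0 N" "X N"]) (use * that in auto)
    then have "\<forall>\<^sub>F N in sequentially. (\<Sum>i\<le>N. state_weight N i * (2 * G (real i / real N) - 1)) /
        (\<Sum>i\<le>N. state_weight N i) = s N"
      by (intro eventually_sequentiallyI[of 1])
    then show "s \<longlonglongrightarrow> 2 * pstar - 1"
      using drift_limit[of pstar] * by (blast intro: Lim_transform_eventually)
  qed
qed

end
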